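(* Let $F$ be a field with algebraic closure $\overline{F}$, $m\ge1$, and let $P_1,\ldots,P_m$ be nonconstant monic polynomials over $F$. Define $$\Psi(P_1,\ldots,P_m)=\prod_{\gamma\in\overline{F}}(X-\gamma)^{f(\gamma)},\qquad f(\gamma)=\max\{\lambda_1(P_1)\wedge\cdots\wedge\lambda_m(P_m): (\lambda_1,\dots,\lambda_m)\in\overline{F}^{m},\ \lambda_1+\cdots+\lambda_m=\gamma\}.$$ Then: (1) $\Psi(P_1,\ldots,P_m)$ is a polynomial over $F$; (2) $L(P_1)\ast\cdots\ast L(P_m)=L(\Psi(P_1,\ldots,P_m))$.
   Context: $\mathcal{C}_F$ is the set of all sequences $(s_n)_{n\ge0}$ over $F$. For a monic polynomial $P=X^d+c_{d-1}X^{d-1}+\cdots+c_0\in F[X]$, $L(P)$ is the $F$-vector space of all sequences $(s_n)_{n\ge0}$ over $F$ with $s_{n+d}+c_{d-1}s_{n+d-1}+\cdots+c_0s_n=0$ for all $n\ge0$. The Hurwitz product of sequences is $(c\ast d)_n=\sum_{i=0}^n\binom{n}{i}c_id_{n-i}$, and for $F$-subspaces $H,H'$ of $\mathcal{C}_F$, $H\ast H'$ is the subspace spanned by all $c\ast d$ with $c\in H$, $d\in H'$. The operation $\wedge$ on $\mathbb{N}=\{0,1,2,\dots\}$ (depending on the characteristic of $F$): for positive integers $i,j$, $i\wedge j$ is the maximum value of $r+s+1$ over integers $0\le r\le i-1$, $0\le s\le j-1$ with $\binom{r+s}{r}\ne0$ in $F$; and $0\wedge n=n\wedge0=0$ for all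 $n$. It is associative and commutative. For $\lambda\in\overline{F}$, $\lambda(P)\in\mathbb{N}$ denotes the multiplicity of $\lambda$ as a root of $P$ ($0$ if $\lambda$ is not a root). Only finitely many $f(\gamma)$ are nonzero. *)

theory Defs
  imports "HOL-Algebra.Algebraic_Closure_Type" "HOL-Library.Function_Algebras"
begin

definition seq_scale :: "'a::field \<Rightarrow> (nat \<Rightarrow> 'a) \<Rightarrow> nat \<Rightarrow> 'a" where
  "seq_scale a s = (\<lambda>n. a * s n)"

global_interpretation seqs: vector_space "seq_scale :: 'a::field \<Rightarrow> (nat \<Rightarrow> 'a) \<Rightarrow> nat \<Rightarrow> 'a"
  by unfold_locales (auto simp: seq_scale_def fun_eq_iff algebra_simps)

text \<open>The leading coefficient is taken to be 1, so this is meant for monic \<open>P\<close> only.\<close>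

definition lin_rec :: "'a::field poly \<Rightarrow> (nat \<Rightarrow> 'a) set" where
  "lin_rec P = {s. \<forall>n. s (n + Polynomial.degree P) +
      (\<Sum>i<Polynomial.degree P. Polynomial.coeff P i * s (n + i)) = 0}"

definition hurwitz :: "(nat \<Rightarrow> 'a::field) \<Rightarrow> (nat \<Rightarrow> 'a) \<Rightarrow> nat \<Rightarrow> 'a" where
  "hurwitz c d = (\<lambda>n. \<Sum>i\<le>n. of_nat (n choose i) * c i * d (n - i))"

definition hurwitz_space :: "(nat \<Rightarrow> 'a::field) set \<Rightarrow> (nat \<Rightarrow> 'a) set \<Rightarrow> (nat \<Rightarrow> 'a) set" where
  "hurwitz_space H H' = seqs.span {hurwitz c d | c d. c \<in> H \<and> d \<in> H'}"

text \<open>The type argument supplies the field in which the binomial coefficients are evaluated.\<close>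

definition wedge :: "'a::field itself \<Rightarrow> nat \<Rightarrow> nat \<Rightarrow> nat" where
  "wedge F i j = (if i = 0 \<or> j = 0 then 0
     else Max {r + s + 1 | r s. r \<le> i - 1 \<and> s \<le> j - 1 \<and> (of_nat ((r + s) choose r) :: 'a) \<noteq> 0})"

text \<open>\<open>iter f [x\<^sub>1, \<dots>, x\<^sub>m] = f (\<dots> (f x\<^sub>1 x\<^sub>2) \<dots>) x\<^sub>m\<close>, for \<open>m \<ge> 1\<close>.\<close>

definition iter :: "('b \<Rightarrow> 'b \<Rightarrow> 'b) \<Rightarrow> 'b list \<Rightarrow> 'b" where
  "iter f xs = foldl f (hd xs) (tl xs)"

definition root_mult :: "'a::field alg_closure \<Rightarrow> 'a poly \<Rightarrow> nat" where
  "root_mult \<mu> P = Polynomial.order \<mu> (map_poly to_ac P)"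

text \<open>
  The set of tuples is infinite in general, but for nonzero polynomials the multiplicities are
  bounded by the degrees, so the set of values under \<open>Max\<close> is finite; it is nonempty if
  \<open>Ps \<noteq> []\<close>.
\<close>

definition psi_exp :: "'a::field poly list \<Rightarrow> 'a alg_closure \<Rightarrow> nat" where
  "psi_exp Ps \<gamma> = Max {iter (wedge TYPE('a)) (map2 root_mult \<mu>s Ps) | \<mu>s.
     length \<mu>s = length Ps \<and> sum_list \<mu>s = \<gamma>}"

text \<open>Only finitely many factors are different from 1; the product runs over these.\<close>

definition Psi :: "'a::field poly list \<Rightarrow> 'a alg_closure poly" where
  "Psi Ps = (\<Prod>\<gamma> | psi_exp Ps \<gamma> \<noteq> 0. [:-\<gamma>, 1:] ^ psi_exp Ps \<gamma>)"

end

theory Submission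
  imports Defs
begin

text \<open>
  Over \<open>K = \<close> the algebraic closure, \<open>L(P)\<close> has the basis of sequences
  \<open>e\<^bsub>\<gamma>,t\<^esub> = (\<lambda>n. (n choose t) \<gamma>\<^bsup>n - t\<^esup>)\<close> with \<open>t < \<gamma>(P)\<close>, and the Hurwitz product of \<open>e\<^bsub>\<alpha>,r\<^esub>\<close> and \<open>e\<^bsub>\<beta>,s\<^esub>\<close>
  is \<open>((r + s) choose r) e\<^bsub>\<alpha>+\<beta>,r+s\<^esub>\<close>. By Pascal's rule the values \<open>r + s\<close> with a nonzero
  coefficient form an initial segment of the natural numbers, whose length is the wedge of the
  multiplicities; this proves (2) over \<open>K\<close>.

  To descend to \<open>F\<close>, note that \<open>L(P)\<close> over \<open>K\<close> is spanned by \<open>L(P)\<close> over \<open>F\<close>, so \<open>L(\<Psi>)\<close> is the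
  \<open>K\<close>-span of the product space \<open>H\<close> over \<open>F\<close>. An \<open>F\<close>-linear retraction \<open>K \<rightarrow> F\<close>, applied to the
  coefficients of \<open>\<Psi>\<close>, yields a polynomial \<open>Q\<close> over \<open>F\<close> of the same degree whose recurrence also
  holds on \<open>H\<close>, hence on \<open>L(\<Psi>)\<close>; therefore \<open>Q = \<Psi>\<close>. Applied to sequences, the retraction gives
  \<open>L(Q) = H\<close>. No Galois theory is involved, so \<open>F\<close> may be imperfect.
\<close>

section \<open>Polynomials acting on sequences through the shift\<close>

text \<open>The action of a polynomial on sequences in which \<open>X\<close> acts as the left shift.\<close>

definition act :: "'a::field poly \<Rightarrow> (nat \<Rightarrow> 'a) \<Rightarrow> nat \<Rightarrow> 'a" where
  "act p s = (\<lambda>n. \<Sum>i\<le>Polynomial.degree p. Polynomial.coeff p i * s (n + i))"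

lemma act_eq_sum:
  assumes "Polynomial.degree p \<le> d"
  shows "act p s n = (\<Sum>i\<le>d. Polynomial.coeff p i * s (n + i))"
  unfolding act_def using assms
  by (intro sum.mono_neutral_left) (auto simp: coeff_eq_0)

lemma act_pCons: "act (pCons a p) s n = a * s n + act p s (Suc n)"
proof -
  have "act (pCons a p) s n =
      (\<Sum>i\<le>Suc (Polynomial.degree p). Polynomial.coeff (pCons a p) i * s (n + i))"
    by (rule act_eq_sum) (rule degree_pCons_le)
  also have "\<dots> = a * s n + act p s (Suc n)"
    by (simp add: sum.atMost_Suc_shift act_def del: sum.atMost_Suc)
  finally show ?thesis .
qed

lemma act_0 [simp]: "act 0 s = 0"
  by (simp add: act_def fun_eq_iff)

lemma act_1 [simp]: "act 1 s = s"
  by (simp add: act_def fun_eq_iff)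

lemma act_add_poly: "act (p + q) s n = act p s n + act q s n"
proof -
  define d where "d = max (Polynomial.degree p) (Polynomial.degree q)"
  have "Polynomial.degree p \<le> d" "Polynomial.degree q \<le> d" "Polynomial.degree (p + q) \<le> d"
    by (auto simp: d_def intro: degree_add_le)
  then show ?thesis
    by (simp add: act_eq_sum algebra_simps sum.distrib)
qed

lemma act_smult: "act (Polynomial.smult a p) s n = a * act p s n"
proof -
  have "Polynomial.degree (Polynomial.smult a p) \<le> Polynomial.degree p" by simp
  then have "act (Polynomial.smult a p) s n
      = (\<Sum>i\<le>Polynomial.degree p. Polynomial.coeff (Polynomial.smult a p) i * s (n + i))"
    by (rule act_eq_sum)
  then show ?thesis by (simp add: act_def sum_distrib_left mult.assoc)
qed

text \<open>Makes the sequences a module over the polynomial ring, so the factors of a polynomial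
  can be applied one after the other.\<close>

lemma act_mult: "act (p * q) s = act p (act q s)"
proof -
  have "act (p * q) s n = act p (act q s) n" for n
    by (induction p arbitrary: n) (simp_all add: act_pCons act_add_poly act_smult)
  then show ?thesis by blast
qed

lemma act_zero_seq [simp]: "act p 0 = 0" "act p (\<lambda>_. 0) = (\<lambda>_. 0)"
  by (simp_all add: act_def fun_eq_iff)

lemma act_add: "act p (s + t) = act p s + act p t"
  by (simp add: act_def fun_eq_iff algebra_simps sum.distrib)

lemma act_scale: "act p (seq_scale a s) = seq_scale a (act p s)"
  by (simp add: act_def seq_scale_def fun_eq_iff sum_distrib_left algebra_simps)

section \<open>Solution spaces and initial values\<close>

lemma lin_rec_iff_act:
  assumes "Polynomial.lead_coeff P = 1"
  shows "s \<in> lin_rec P \<longleftrightarrow> act P s = 0"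
  using assms by (simp add: lin_rec_def act_def fun_eq_iff lessThan_Suc_atMost [symmetric] add.commute)

lemma subspace_lin_rec:
  assumes "Polynomial.lead_coeff P = 1"
  shows "seqs.subspace (lin_rec P)"
  unfolding seqs.subspace_def
  by (auto simp: lin_rec_iff_act [OF assms] act_add act_scale)

text \<open>The recurrence determines every later term from the \<open>Polynomial.degree P\<close>
  terms before it. This is the uniqueness half of the initial value problem.\<close>

lemma lin_rec_eqI:
  assumes "s \<in> lin_rec P" "t \<in> lin_rec P" "\<And>n. n < Polynomial.degree P \<Longrightarrow> s n = t n"
  shows "s = t"
proof
  define d where "d = Polynomial.degree P"
  fix n show "s n = t n"
  proof (induction n rule: less_induct)
    case (less n)
    show ?case
    proof (cases "n < d")
      case True then show ?thesis using assms(3) by (simp add: d_def)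
    next
      case False
      then obtain k where n: "n = k + d" by (metis add.commute le_Suc_ex not_less)
      have "(\<Sum>i<d. Polynomial.coeff P i * s (k + i)) = (\<Sum>i<d. Polynomial.coeff P i * t (k + i))"
        by (intro sum.cong) (auto simp: n intro!: less.IH)
      moreover have "s (k + d) + (\<Sum>i<d. Polynomial.coeff P i * s (k + i)) = 0"
        "t (k + d) + (\<Sum>i<d. Polynomial.coeff P i * t (k + i)) = 0"
        using assms(1,2) by (auto simp: lin_rec_def d_def)
      ultimately show ?thesis by (simp add: n eq_neg_iff_add_eq_0 [symmetric])
    qed
  qed
qed

text \<open>The existence half of the initial value problem, with the initial values taken from
  \<open>a\<close>.\<close>

function rec_seq :: "'a::field poly \<Rightarrow> (nat \<Rightarrow> 'a) \<Rightarrow> nat \<Rightarrow> 'a" where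
  "rec_seq P a n = (if n < Polynomial.degree P then a n else
     - (\<Sum>i<Polynomial.degree P. Polynomial.coeff P i * rec_seq P a (n - Polynomial.degree P + i)))"
  by auto
termination by (relation "measure (\<lambda>(P, a, n). n)") auto

declare rec_seq.simps [simp del]

lemma rec_seq_init: "n < Polynomial.degree P \<Longrightarrow> rec_seq P a n = a n"
  by (subst rec_seq.simps) simp

lemma rec_seq_in_lin_rec: "rec_seq P a \<in> lin_rec P"
  unfolding lin_rec_def
  by (rule CollectI, rule allI, subst rec_seq.simps) simp

section \<open>Exponential sequences as Jordan chains of the shift\<close>

text \<open>The \<open>r\<close>-th Hasse derivative of the geometric sequence of \<open>a\<close>,
  which stays meaningful in positive characteristic. For \<open>n < r\<close> the binomial
  coefficient vanishes, so the truncated exponent is harmless.\<close>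

definition exp_seq :: "'a::field \<Rightarrow> nat \<Rightarrow> nat \<Rightarrow> 'a" where
  "exp_seq a r = (\<lambda>n. of_nat (n choose r) * a ^ (n - r))"

lemma exp_seq_at_0: "exp_seq a r 0 = (if r = 0 then 1 else 0)"
  by (cases r) (simp_all add: exp_seq_def)

lemma exp_seq_Suc_0: "exp_seq a 0 (Suc n) = a * exp_seq a 0 n"
  by (simp add: exp_seq_def)

lemma exp_seq_Suc_Suc: "exp_seq a (Suc r) (Suc n) = a * exp_seq a (Suc r) n + exp_seq a r n"
proof (cases "n < Suc r")
  case True
  then show ?thesis by (simp add: exp_seq_def binomial_eq_0)
next
  case False
  then have "n - r = Suc (n - Suc r)" by simp
  then show ?thesis by (simp add: exp_seq_def algebra_simps)
qed

text \<open>For fixed \<open>a\<close> these sequences form a Jordan chain of the shift with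
  eigenvalue \<open>a\<close>.\<close>

lemma act_linear_exp_seq:
  "act [:-a, 1:] (exp_seq a 0) = 0"
  "act [:-a, 1:] (exp_seq a (Suc r)) = exp_seq a r"
  by (auto simp: fun_eq_iff act_pCons exp_seq_Suc_0 exp_seq_Suc_Suc)

lemma act_linear_power_exp_seq:
  "act ([:-a, 1:] ^ n) (exp_seq a r) = (if n \<le> r then exp_seq a (r - n) else 0)"
proof (induction n)
  case 0
  then show ?case by simp
next
  case (Suc n)
  show ?case
  proof (cases "n < r")
    case True
    then have "r - n = Suc (r - Suc n)" by simp
    then show ?thesis using True
      by (simp add: act_mult Suc.IH act_linear_exp_seq del: mult_pCons_left)
  next
    case False
    then show ?thesis
      by (auto simp: act_mult Suc.IH act_linear_exp_seq simp del: mult_pCons_left)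
  qed
qed

lemma act_exp_seq_0: "act p (exp_seq a 0) = seq_scale (poly p a) (exp_seq a 0)"
proof -
  have "act p (exp_seq a 0) n = poly p a * exp_seq a 0 n" for n
    by (induction p arbitrary: n) (simp_all add: act_pCons exp_seq_Suc_0 algebra_simps)
  then show ?thesis by (auto simp: seq_scale_def)
qed

lemma act_linear_eq_0D:
  assumes "act [:-a, 1:] s = 0"
  shows "s = seq_scale (s 0) (exp_seq a 0)"
proof
  fix n
  have step: "s (Suc n) = a * s n" for n
    using fun_cong [OF assms, of n] by (simp add: act_pCons)
  show "s n = seq_scale (s 0) (exp_seq a 0) n"
    by (induction n) (auto simp: seq_scale_def step exp_seq_def)
qed

section \<open>Hurwitz products of exponential sequences\<close>

text \<open>Leibniz rule: by Pascal's rule the shift is a derivation for the Hurwitz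
  product.\<close>

lemma hurwitz_Suc:
  "hurwitz c d (Suc n) = hurwitz (\<lambda>k. c (Suc k)) d n + hurwitz c (\<lambda>k. d (Suc k)) n"
proof -
  have "(\<Sum>i\<le>n. of_nat (n choose Suc i) * c (Suc i) * d (n - i)) + c 0 * d (Suc n)
      = (\<Sum>i\<le>Suc n. of_nat (n choose i) * c i * d (Suc n - i))"
    by (simp add: sum.atMost_Suc_shift del: sum.atMost_Suc)
  \<comment> \<open>The last term drops out because \<open>n choose Suc n\<close> is zero.\<close>
  also have "\<dots> = (\<Sum>i\<le>n. of_nat (n choose i) * c i * d (Suc (n - i)))"
    by (simp add: binomial_eq_0 Suc_diff_le)
  finally show ?thesis
    by (simp add: hurwitz_def sum.atMost_Suc_shift sum.distrib algebra_simps del: sum.atMost_Suc)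
qed

text \<open>Has the shape of the induction step of \<open>seqs.span_induct_alt\<close>.\<close>

lemma hurwitz_linear_left:
  "hurwitz (seq_scale a c + c') d = seq_scale a (hurwitz c d) + hurwitz c' d"
  by (simp add: hurwitz_def seq_scale_def fun_eq_iff algebra_simps sum.distrib sum_distrib_left)

lemma hurwitz_linear_right:
  "hurwitz c (seq_scale a d + d') = seq_scale a (hurwitz c d) + hurwitz c d'"
  by (simp add: hurwitz_def seq_scale_def fun_eq_iff algebra_simps sum.distrib sum_distrib_left)

lemma hurwitz_zero: "hurwitz 0 d = 0" "hurwitz c 0 = 0"
  by (auto simp: hurwitz_def fun_eq_iff)

text \<open>In characteristic 0 the exponential generating function of \<open>exp_seq a r\<close> is
  \<open>x^r / r! * exp (a * x)\<close>, and the Hurwitz product multiplies such functions.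
  Induction on \<open>n\<close> with the Leibniz rule avoids the factorials and works in every
  characteristic.\<close>

lemma hurwitz_exp_seq:
  "hurwitz (exp_seq a r) (exp_seq b s)
    = seq_scale (of_nat ((r + s) choose r)) (exp_seq (a + b) (r + s))"
proof -
  have left0: "hurwitz (\<lambda>k. exp_seq a 0 (Suc k)) d n = a * hurwitz (exp_seq a 0) d n" for a d n
    by (simp add: hurwitz_def exp_seq_Suc_0 sum_distrib_left algebra_simps)
  have right0: "hurwitz c (\<lambda>k. exp_seq b 0 (Suc k)) n = b * hurwitz c (exp_seq b 0) n" for b c n
    by (simp add: hurwitz_def exp_seq_Suc_0 sum_distrib_left algebra_simps)
  have left: "hurwitz (\<lambda>k. exp_seq a (Suc r) (Suc k)) d n
      = a * hurwitz (exp_seq a (Suc r)) d n + hurwitz (exp_seq a r) d n" for a d n r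
    by (simp add: hurwitz_def exp_seq_Suc_Suc sum_distrib_left sum.distrib algebra_simps)
  have right: "hurwitz c (\<lambda>k. exp_seq b (Suc r) (Suc k)) n
      = b * hurwitz c (exp_seq b (Suc r)) n + hurwitz c (exp_seq b r) n" for b c n r
    by (simp add: hurwitz_def exp_seq_Suc_Suc sum_distrib_left sum.distrib algebra_simps)
  have "hurwitz (exp_seq a r) (exp_seq b s) n
      = of_nat ((r + s) choose r) * exp_seq (a + b) (r + s) n" for n
  proof (induction n arbitrary: r s)
    case 0
    then show ?case by (simp add: hurwitz_def exp_seq_at_0)
  next
    case (Suc n)
    show ?case
    proof (cases r)
      case 0
      then show ?thesis
        unfolding hurwitz_Suc 0 left0 Suc.IH
        by (cases s) (simp_all only: right0 right Suc.IH, simp_all add: exp_seq_Suc_0 exp_seq_Suc_Suc algebra_simps)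
    next
      case r: (Suc r')
      show ?thesis
      proof (cases s)
        case 0
        then show ?thesis
          unfolding hurwitz_Suc r 0 left right0 Suc.IH by (simp add: exp_seq_Suc_Suc algebra_simps)
      next
        case s: (Suc s')
        \<comment> \<open>The two terms of index \<open>r + s - 1\<close>, one from each half of the
          Leibniz rule, combine by this identity.\<close>
        have "(r + s choose r) = (r' + s choose r') + (r + s' choose r)"
          by (simp add: r s)
        then show ?thesis
          unfolding hurwitz_Suc r s left right Suc.IH
          by (simp add: exp_seq_Suc_Suc algebra_simps del: binomial_Suc_Suc)
      qed
    qed
  qed
  then show ?thesis by (auto simp: seq_scale_def)
qed

section \<open>Hurwitz product spaces on generators\<close>

text \<open>By bilinearity generators suffice; there is one span induction for each
  argument.\<close>

lemma hurwitz_space_span: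
  "hurwitz_space (seqs.span A) (seqs.span B) = seqs.span {hurwitz c d | c d. c \<in> A \<and> d \<in> B}"
    (is "_ = seqs.span ?S")
proof -
  have 1: "hurwitz c d \<in> seqs.span ?S" if "c \<in> A" "d \<in> seqs.span B" for c d
    using that(2)
  proof (induction rule: seqs.span_induct_alt)
    case base
    show ?case unfolding hurwitz_zero by (rule seqs.span_zero)
  next
    case (step a x y)
    then show ?case unfolding hurwitz_linear_right using that(1)
      by (blast intro: seqs.span_add seqs.span_scale seqs.span_base)
  qed
  have "hurwitz c d \<in> seqs.span ?S" if "c \<in> seqs.span A" "d \<in> seqs.span B" for c d
    using that(1)
  proof (induction rule: seqs.span_induct_alt)
    case base
    show ?case unfolding hurwitz_zero by (rule seqs.span_zero)
  next
    case (step a x y)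
    then show ?case unfolding hurwitz_linear_left using that(2)
      by (blast intro: seqs.span_add seqs.span_scale 1)
  qed
  then have "{hurwitz c d | c d. c \<in> seqs.span A \<and> d \<in> seqs.span B} \<subseteq> seqs.span ?S"
    by blast
  moreover have "?S \<subseteq> seqs.span {hurwitz c d | c d. c \<in> seqs.span A \<and> d \<in> seqs.span B}"
    by (blast intro: seqs.span_base)
  ultimately show ?thesis unfolding hurwitz_space_def seqs.span_eq by blast
qed

text \<open>Recording a space by its index pairs turns the Hurwitz product of spaces into the purely
  combinatorial \<open>exp_conv\<close>.\<close>

definition exp_span :: "('a::field \<times> nat) set \<Rightarrow> (nat \<Rightarrow> 'a) set" where
  "exp_span E = seqs.span {exp_seq a r | a r. (a, r) \<in> E}"

definition exp_conv :: "('a::field \<times> nat) set \<Rightarrow> ('a \<times> nat) set \<Rightarrow> ('a \<times> nat) set" where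
  "exp_conv E E' = {(a + b, r + s) | a r b s.
     (a, r) \<in> E \<and> (b, s) \<in> E' \<and> of_nat ((r + s) choose r) \<noteq> (0 :: 'a)}"

text \<open>A product of two generators is zero or a nonzero multiple of a single exponential
  sequence, and nonzero coefficients can be divided out.\<close>

lemma hurwitz_space_exp_span:
  "hurwitz_space (exp_span E) (exp_span E') = exp_span (exp_conv E E')"
proof -
  let ?S = "{hurwitz c d | c d. c \<in> {exp_seq a r | a r. (a, r) \<in> E} \<and> d \<in> {exp_seq a r | a r. (a, r) \<in> E'}}"
  have "?S \<subseteq> exp_span (exp_conv E E')"
  proof safe
    fix a r b s assume *: "(a, r) \<in> E" "(b, s) \<in> E'"
    show "hurwitz (exp_seq a r) (exp_seq b s) \<in> exp_span (exp_conv E E')"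
    proof (cases "of_nat ((r + s) choose r) = (0 :: 'a)")
      case True
      then show ?thesis
        unfolding hurwitz_exp_seq True seqs.scale_zero_left exp_span_def by (intro seqs.span_zero)
    next
      case False
      then have "(a + b, r + s) \<in> exp_conv E E'" using * by (auto simp: exp_conv_def)
      then show ?thesis unfolding exp_span_def hurwitz_exp_seq
        by (blast intro: seqs.span_scale seqs.span_base)
    qed
  qed
  moreover have "exp_seq a t \<in> seqs.span ?S" if "(a, t) \<in> exp_conv E E'" for a t
  proof -
    obtain b r c s where *: "a = b + c" "t = r + s" "(b, r) \<in> E" "(c, s) \<in> E'"
      and nz: "of_nat ((r + s) choose r) \<noteq> (0 :: 'a)"
      using \<open>(a, t) \<in> exp_conv E E'\<close> unfolding exp_conv_def by blast
    have "exp_seq a t = seq_scale (inverse (of_nat ((r + s) choose r)))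
        (hurwitz (exp_seq b r) (exp_seq c s))"
      unfolding hurwitz_exp_seq *(1,2) seqs.scale_scale left_inverse [OF nz] seqs.scale_one ..
    moreover have "hurwitz (exp_seq b r) (exp_seq c s) \<in> ?S" using * by blast
    ultimately show ?thesis by (simp only: seqs.span_scale seqs.span_base)
  qed
  then have "{exp_seq a t | a t. (a, t) \<in> exp_conv E E'} \<subseteq> seqs.span ?S"
    by blast
  ultimately have "seqs.span ?S = exp_span (exp_conv E E')"
    unfolding exp_span_def seqs.span_eq by (rule conjI)
  then show ?thesis unfolding exp_span_def hurwitz_space_span .
qed

section \<open>Solution spaces over an algebraically closed field\<close>

lemma act_power_dvd_exp_seq:
  assumes "[:-a, 1:] ^ Suc t dvd P"
  shows "act P (exp_seq a t) = 0"
proof -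
  obtain R where "P = R * [:-a, 1:] ^ Suc t" using assms by (metis dvdE mult.commute)
  then show ?thesis
    by (simp add: act_mult act_linear_power_exp_seq del: power_Suc)
qed

text \<open>Induction on the degree, splitting off one root \<open>l\<close>: a solution for
  \<open>P\<close> differs from a solution for the cofactor \<open>R\<close> by a multiple of one
  further exponential sequence.\<close>

lemma lin_rec_eq_exp_span:
  fixes P :: "'a::alg_closed_field poly"
  assumes "Polynomial.lead_coeff P = 1"
  shows "lin_rec P = exp_span {(a, t). t < Polynomial.order a P}"
  using assms
proof (induction "Polynomial.degree P" arbitrary: P)
  case 0
  then have P: "P = 1" by (metis degree_0_id of_nat_1 one_poly_eq_simps(1) pCons_one)
  show ?case
    by (auto simp: P lin_rec_iff_act exp_span_def)
next
  case (Suc d)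
  then obtain l where "poly P l = 0"
    by (metis alg_closed_imp_poly_has_root zero_less_Suc)
  then obtain R where P: "P = [:-l, 1:] * R"
    by (metis poly_eq_0_iff_dvd dvdE)
  have R1: "Polynomial.lead_coeff R = 1"
    using Suc.prems unfolding P lead_coeff_mult by simp
  then have R0: "R \<noteq> 0" by auto
  have "Polynomial.degree P = Suc (Polynomial.degree R)"
    unfolding P using R0 by (subst degree_mult_eq) auto
  then have IH: "lin_rec R = exp_span {(a, t). t < Polynomial.order a R}"
    using Suc.hyps R1 by simp
  \<comment> \<open>The multiplicity of \<open>l\<close> in \<open>P\<close> is
    \<open>m + 1\<close>, so \<open>exp_seq l m\<close> is the generator gained in passing from
    \<open>R\<close> to \<open>P\<close>.\<close>
  define m where "m = Polynomial.order l R"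
  have P0: "P \<noteq> 0" using Suc.prems by auto
  have le: "Polynomial.order a R \<le> Polynomial.order a P" for a
    using P0 P by (metis dvd_imp_order_le dvd_triv_right)
  have ml: "m < Polynomial.order l P"
    using P0 order_power_n_n [of l 1] unfolding P m_def by (subst order_mult) auto
  obtain T where T: "R = [:-l, 1:] ^ m * T" "\<not> [:-l, 1:] dvd T"
    using order_decomp [OF R0, of l] unfolding m_def by blast
  then have T0: "poly T l \<noteq> 0" by (simp add: poly_eq_0_iff_dvd)
  \<comment> \<open>The power of \<open>[:-l, 1:]\<close> in \<open>R\<close> moves
    \<open>exp_seq l m\<close> down to the eigenvector \<open>exp_seq l 0\<close>, on which
    \<open>T\<close> acts by the nonzero scalar \<open>poly T l\<close>.\<close>
  have Rm: "act R (exp_seq l m) = seq_scale (poly T l) (exp_seq l 0)"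
  proof -
    have "act R (exp_seq l m) = act T (act ([:-l, 1:] ^ m) (exp_seq l m))"
      unfolding T(1) act_mult [symmetric] by (simp add: mult.commute)
    then show ?thesis by (simp add: act_linear_power_exp_seq act_exp_seq_0)
  qed
  show ?case
  proof
    show "exp_span {(a, t). t < Polynomial.order a P} \<subseteq> lin_rec P"
      unfolding exp_span_def
    proof (rule seqs.span_minimal)
      show "seqs.subspace (lin_rec P)" using Suc.prems by (rule subspace_lin_rec)
      show "{exp_seq a r |a r. (a, r) \<in> {(a, t). t < Polynomial.order a P}} \<subseteq> lin_rec P"
        using Suc.prems
        by (auto simp: lin_rec_iff_act order_divides simp del: power_Suc intro!: act_power_dvd_exp_seq)
    qed
  next
    show "lin_rec P \<subseteq> exp_span {(a, t). t < Polynomial.order a P}"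
    proof
      fix s assume "s \<in> lin_rec P"
      then have "act [:-l, 1:] (act R s) = 0"
        using Suc.prems by (simp add: lin_rec_iff_act P act_mult del: mult_pCons_left)
      then obtain c where c: "act R s = seq_scale c (exp_seq l 0)"
        using act_linear_eq_0D by blast
      \<comment> \<open>The coefficient is chosen so that \<open>R\<close> acts on \<open>u\<close>
        as on \<open>s\<close>; then \<open>s - u\<close> is a solution for
        \<open>R\<close>.\<close>
      define u where "u = seq_scale (c / poly T l) (exp_seq l m)"
      have "act R u = act R s"
        unfolding u_def act_scale Rm c using T0 by (simp add: seq_scale_def)
      have "act R (s - u) = 0"
        using act_add [of R "s - u" u] \<open>act R u = act R s\<close> by simp
      then have "s - u \<in> exp_span {(a, t). t < Polynomial.order a R}"
        using R1 IH lin_rec_iff_act by blast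
      also have "\<dots> \<subseteq> exp_span {(a, t). t < Polynomial.order a P}"
        unfolding exp_span_def using le by (intro seqs.span_mono) (auto intro: less_le_trans)
      finally have "s - u \<in> exp_span {(a, t). t < Polynomial.order a P}" .
      moreover have "u \<in> exp_span {(a, t). t < Polynomial.order a P}"
        unfolding u_def exp_span_def using ml
        by (intro seqs.span_scale seqs.span_base) auto
      ultimately have "(s - u) + u \<in> exp_span {(a, t). t < Polynomial.order a P}"
        unfolding exp_span_def by (rule seqs.span_add)
      then show "s \<in> exp_span {(a, t). t < Polynomial.order a P}" by simp
    qed
  qed
qed

section \<open>The wedge operation\<close>

text \<open>The set \<open>T\<close> of attained sums \<open>r + s\<close> is closed downwards, so a
  number is at most its maximum exactly if it lies in \<open>T\<close>. In this form the wedge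
  matches the condition in \<open>exp_conv\<close>.\<close>

lemma less_wedge_iff:
  "t < wedge TYPE('a::field) i j \<longleftrightarrow>
     (\<exists>r<i. \<exists>s<j. t = r + s \<and> of_nat ((r + s) choose r) \<noteq> (0 :: 'a))"
proof (cases "i = 0 \<or> j = 0")
  case True
  then show ?thesis by (auto simp: wedge_def)
next
  case False
  define T where "T = {r + s | r s. r < i \<and> s < j \<and> of_nat ((r + s) choose r) \<noteq> (0 :: 'a)}"
  have "T \<subseteq> {..i + j}" unfolding T_def by auto
  then have fin: "finite T" by (rule finite_subset) simp
  have "0 \<in> T" using False unfolding T_def by fastforce
  have "wedge TYPE('a) i j = Max (Suc ` T)"
    using False unfolding wedge_def T_def
    by (auto intro!: arg_cong [of _ _ Max] simp: image_def less_Suc_eq_le [symmetric])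
  also have "\<dots> = Suc (Max T)"
    using fin \<open>0 \<in> T\<close> by (subst mono_Max_commute [symmetric]) (auto simp: mono_def)
  finally have wedge: "wedge TYPE('a) i j = Suc (Max T)" .
  \<comment> \<open>By Pascal's rule a nonzero binomial coefficient has a nonzero one above it.\<close>
  have down: "n \<in> T" if "Suc n \<in> T" for n
  proof -
    from that obtain r s where *: "Suc n = r + s" "r < i" "s < j"
      "of_nat ((r + s) choose r) \<noteq> (0 :: 'a)"
      unfolding T_def by auto
    show ?thesis
    proof (cases r)
      case 0
      then have "n = 0 + (s - 1)" "0 < i" "s - 1 < j" using * by auto
      then show ?thesis unfolding T_def by fastforce
    next
      case r: (Suc r')
      show ?thesis
      proof (cases s)
        case 0
        then have "n = r' + 0" "r' < i" "0 < j" using * r by auto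
        then show ?thesis unfolding T_def by fastforce
      next
        case s: (Suc s')
        have "(r + s) choose r = ((r' + s) choose r') + ((r + s') choose r)"
          by (simp add: r s)
        then have "of_nat ((r' + s) choose r') \<noteq> (0 :: 'a) \<or> of_nat ((r + s') choose r) \<noteq> (0 :: 'a)"
          using *(4) by (metis add_0 of_nat_add)
        moreover have "n = r' + s" "n = r + s'" "r' < i" "s' < j" using * r s by auto
        ultimately show ?thesis unfolding T_def using *(2,3) by blast
      qed
    qed
  qed
  \<comment> \<open>Steps down from the maximum reach every smaller number; truncated subtraction
    stays at 0 once it gets there.\<close>
  have "Max T - k \<in> T" for k
  proof (induction k)
    case 0
    show ?case using Max_in [OF fin] \<open>0 \<in> T\<close> by auto
  next
    case (Suc k)
    show ?case
    proof (cases "Max T - k")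
      case 0
      then show ?thesis using Suc by simp
    next
      case (Suc m)
      then have "m = Max T - Suc k" by simp
      then show ?thesis using Suc.IH Suc down by metis
    qed
  qed
  then have "t \<in> T" if "t \<le> Max T"
    using that by (metis diff_diff_cancel)
  then have "t < wedge TYPE('a) i j \<longleftrightarrow> t \<in> T"
    unfolding wedge using Max_ge [OF fin] by (auto simp: less_Suc_eq_le)
  then show ?thesis unfolding T_def by auto
qed

lemma wedge_le_add: "wedge TYPE('a::field) i j \<le> i + j"
proof (rule ccontr)
  assume "\<not> ?thesis"
  then have "i + j < wedge TYPE('a) i j" by simp
  then show False unfolding less_wedge_iff by auto
qed

lemma iter_singleton [simp]: "iter f [x] = x"
  by (simp add: iter_def)

lemma iter_snoc: "xs \<noteq> [] \<Longrightarrow> iter f (xs @ [x]) = f (iter f xs) x"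
  by (simp add: iter_def)

text \<open>A crude bound, used to show that the set of values under \<open>Max\<close> in
  \<open>psi_exp\<close> is finite.\<close>

lemma iter_wedge_le: "xs \<noteq> [] \<Longrightarrow> iter (wedge TYPE('a::field)) xs \<le> sum_list xs"
proof (induction xs rule: rev_nonempty_induct)
  case (snoc x xs)
  have "wedge TYPE('a) (iter (wedge TYPE('a)) xs) x \<le> iter (wedge TYPE('a)) xs + x"
    by (rule wedge_le_add)
  with snoc show ?case by (simp add: iter_snoc)
qed simp

section \<open>Root multiplicities and the exponents of \<open>Psi\<close>\<close>

lemma coeff_map_to_ac [simp]: "Polynomial.coeff (map_poly to_ac P) i = to_ac (Polynomial.coeff P i)"
  by (simp add: coeff_map_poly)

lemma degree_map_to_ac [simp]: "Polynomial.degree (map_poly to_ac P) = Polynomial.degree P"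
  by (rule degree_map_poly) simp

lemma root_mult_le_degree: "P \<noteq> 0 \<Longrightarrow> root_mult \<mu> P \<le> Polynomial.degree P"
  unfolding root_mult_def
  by (metis degree_map_to_ac order_degree coeff_map_to_ac leading_coeff_0_iff to_ac_eq_0_iff)

text \<open>The values are bounded by the sum of the degrees and at least one tuple exists, so the
  maximum exceeds \<open>t\<close> exactly if some value does.\<close>

lemma less_psi_exp_iff:
  fixes Ps :: "'a::field poly list"
  assumes "Ps \<noteq> []" "0 \<notin> set Ps"
  shows "t < psi_exp Ps \<gamma> \<longleftrightarrow> (\<exists>\<mu>s. length \<mu>s = length Ps \<and> sum_list \<mu>s = \<gamma> \<and>
    t < iter (wedge TYPE('a)) (map2 root_mult \<mu>s Ps))"
proof -
  define S where "S = {iter (wedge TYPE('a)) (map2 root_mult \<mu>s Ps) | \<mu>s.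
     length \<mu>s = length Ps \<and> sum_list \<mu>s = \<gamma>}"
  have sum_le: "sum_list (map2 root_mult \<mu>s Qs) \<le> sum_list (map Polynomial.degree Qs)"
    if "length \<mu>s = length Qs" "0 \<notin> set Qs" for \<mu>s and Qs :: "'a poly list"
    using that by (induction rule: list_induct2) (auto intro!: add_mono root_mult_le_degree)
  have "S \<subseteq> {..sum_list (map Polynomial.degree Ps)}"
  proof
    fix x assume "x \<in> S"
    then obtain \<mu>s where *: "x = iter (wedge TYPE('a)) (map2 root_mult \<mu>s Ps)" "length \<mu>s = length Ps"
      unfolding S_def by blast
    have "map2 root_mult \<mu>s Ps \<noteq> []" using * assms by auto
    then have "x \<le> sum_list (map2 root_mult \<mu>s Ps)" unfolding * by (rule iter_wedge_le)
    also have "\<dots> \<le> sum_list (map Polynomial.degree Ps)" using * assms(2) by (intro sum_le)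
    finally show "x \<in> {..sum_list (map Polynomial.degree Ps)}" by simp
  qed
  then have "finite S" by (rule finite_subset) simp
  moreover have "S \<noteq> {}"
  proof -
    \<comment> \<open>A tuple with sum \<open>\<gamma>\<close>: all entries but the first are
      zero.\<close>
    define \<mu>s where "\<mu>s = \<gamma> # replicate (length Ps - 1) 0"
    have "length \<mu>s = length Ps" "sum_list \<mu>s = \<gamma>"
      using assms(1) by (auto simp: \<mu>s_def sum_list_replicate)
    then show ?thesis unfolding S_def by blast
  qed
  ultimately have "t < Max S \<longleftrightarrow> (\<exists>x\<in>S. t < x)" by (rule Max_gr_iff)
  then show ?thesis unfolding psi_exp_def S_def by blast
qed

lemma psi_exp_singleton:
  assumes "P \<noteq> 0"
  shows "psi_exp [P] \<gamma> = root_mult \<gamma> P"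
proof -
  have "t < psi_exp [P] \<gamma> \<longleftrightarrow> t < root_mult \<gamma> P" for t
    using assms by (subst less_psi_exp_iff) (auto simp: length_Suc_conv)
  then show ?thesis by (metis linorder_neq_iff)
qed

text \<open>Reconciles the wedge, which tests binomial coefficients in the base field, with
  \<open>exp_conv\<close>, which tests them in the closure.\<close>

lemma of_nat_alg_closure_eq_0_iff: "of_nat n = (0 :: 'a::field alg_closure) \<longleftrightarrow> of_nat n = (0 :: 'a)"
  using to_ac_eq_0_iff [of "of_nat n :: 'a"] by simp

text \<open>Splitting off the last entry of a tuple turns the strict bounds for the maximum and for
  the wedge into existence statements, which together say membership in
  \<open>exp_conv\<close>.\<close>

lemma psi_exp_snoc:
  fixes Ps :: "'a::field poly list"
  assumes "Ps \<noteq> []" "0 \<notin> set Ps" "P \<noteq> 0"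
  shows "{(\<gamma>, t). t < psi_exp (Ps @ [P]) \<gamma>}
    = exp_conv {(\<gamma>, t). t < psi_exp Ps \<gamma>} {(\<gamma>, t). t < root_mult \<gamma> P}"
proof -
  have "t < psi_exp (Ps @ [P]) \<gamma> \<longleftrightarrow>
    (\<exists>a r b s. \<gamma> = a + b \<and> t = r + s \<and> r < psi_exp Ps a \<and> s < root_mult b P \<and>
      of_nat ((r + s) choose r) \<noteq> (0 :: 'a alg_closure))" (is "_ \<longleftrightarrow> ?R") for \<gamma> t
  proof -
    have split: "(\<exists>\<mu>s. length \<mu>s = length (Ps @ [P]) \<and> Z \<mu>s) \<longleftrightarrow>
        (\<exists>\<mu>s b. length \<mu>s = length Ps \<and> Z (\<mu>s @ [b]))" for Z :: "'a alg_closure list \<Rightarrow> bool"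
      by (auto simp: length_Suc_conv_rev)
    have iter: "iter f (map2 root_mult \<mu>s Ps @ [x]) = f (iter f (map2 root_mult \<mu>s Ps)) x"
      if "length \<mu>s = length Ps" for \<mu>s f x
      using that assms(1) by (intro iter_snoc) auto
    have "t < psi_exp (Ps @ [P]) \<gamma> \<longleftrightarrow> (\<exists>\<mu>s. length \<mu>s = length (Ps @ [P]) \<and>
       (sum_list \<mu>s = \<gamma> \<and> t < iter (wedge TYPE('a)) (map2 root_mult \<mu>s (Ps @ [P]))))"
      using assms by (intro less_psi_exp_iff) auto
    also have "\<dots> \<longleftrightarrow> (\<exists>\<mu>s b. length \<mu>s = length Ps \<and> sum_list \<mu>s + b = \<gamma> \<and>
       t < wedge TYPE('a) (iter (wedge TYPE('a)) (map2 root_mult \<mu>s Ps)) (root_mult b P))"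
      unfolding split by (simp add: iter cong: conj_cong)
    also have "\<dots> \<longleftrightarrow> ?R"
      unfolding less_wedge_iff less_psi_exp_iff [OF assms(1,2)] of_nat_alg_closure_eq_0_iff by blast
    finally show ?thesis .
  qed
  then show ?thesis unfolding exp_conv_def by auto
qed

lemma finite_exp_conv: "finite E \<Longrightarrow> finite E' \<Longrightarrow> finite (exp_conv E E')"
  by (rule finite_subset [of _ "(\<lambda>((a, r), (b, s)). (a + b, r + s)) ` (E \<times> E')"])
    (force simp: exp_conv_def)+

lemma finite_root_mult:
  assumes "P \<noteq> 0"
  shows "finite {(\<gamma>, t). t < root_mult \<gamma> P}"
proof -
  have "map_poly to_ac P \<noteq> 0" using assms
    by (metis coeff_map_to_ac coeff_0 leading_coeff_0_iff to_ac_eq_0_iff)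
  then have "finite {\<gamma>. poly (map_poly to_ac P) \<gamma> = 0}"
    by (rule poly_roots_finite)
  then have "finite {\<gamma>. root_mult \<gamma> P \<noteq> 0}"
    by (rule rev_finite_subset) (auto simp: root_mult_def order_root)
  then have "finite ({\<gamma>. root_mult \<gamma> P \<noteq> 0} \<times> {..<Polynomial.degree P})" by simp
  then show ?thesis
    by (rule rev_finite_subset) (auto intro: less_le_trans [OF _ root_mult_le_degree [OF assms]])
qed

lemma finite_psi_exp: "Ps \<noteq> [] \<Longrightarrow> 0 \<notin> set Ps \<Longrightarrow> finite {(\<gamma>, t). t < psi_exp Ps \<gamma>}"
  by (induction Ps rule: rev_nonempty_induct)
    (auto simp: psi_exp_singleton finite_root_mult psi_exp_snoc intro!: finite_exp_conv)

text \<open>Makes \<open>Psi\<close> a genuine product; over an infinite index set it would default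
  to 1.\<close>

lemma finite_psi_exp_support:
  assumes "Ps \<noteq> []" "0 \<notin> set Ps"
  shows "finite {\<gamma>. psi_exp Ps \<gamma> \<noteq> 0}"
proof -
  have "{\<gamma>. psi_exp Ps \<gamma> \<noteq> 0} \<subseteq> fst ` {(\<gamma>, t). t < psi_exp Ps \<gamma>}" by force
  then show ?thesis using finite_psi_exp [OF assms] by (meson finite_imageI finite_subset)
qed

lemma order_prod_linear_powers:
  fixes e :: "'a::field \<Rightarrow> nat"
  assumes "finite A"
  shows "Polynomial.order a (\<Prod>\<gamma>\<in>A. [:-\<gamma>, 1:] ^ e \<gamma>) = (if a \<in> A then e a else 0)"
  using assms
proof (induction A rule: finite_induct)
  case (insert b A)
  have b: "Polynomial.order a ([:-b, 1:] ^ e b) = (if a = b then e b else 0)"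
    by (auto simp: order_power_n_n intro!: order_0I)
  have "(\<Prod>\<gamma>\<in>insert b A. [:-\<gamma>, 1:] ^ e \<gamma>) \<noteq> 0"
    using insert.hyps by (subst prod_zero_iff) auto
  then show ?case using insert by (auto simp: order_mult b)
qed simp

lemma order_Psi:
  assumes "Ps \<noteq> []" "0 \<notin> set Ps"
  shows "Polynomial.order \<gamma> (Psi Ps) = psi_exp Ps \<gamma>"
  unfolding Psi_def using finite_psi_exp_support [OF assms] by (simp add: order_prod_linear_powers)

lemma monic_Psi: "Polynomial.lead_coeff (Psi Ps) = 1"
  unfolding Psi_def by (simp add: lead_coeff_prod lead_coeff_power)

section \<open>Extension of scalars to the algebraic closure\<close>

text \<open>Base change, realised inside the sequences over the closure instead of by a tensor
  product.\<close>

definition extend_scalars :: "(nat \<Rightarrow> 'a::field) set \<Rightarrow> (nat \<Rightarrow> 'a alg_closure) set" where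
  "extend_scalars H = seqs.span ((\<circ>) to_ac ` H)"

lemma to_ac_comp_add: "to_ac \<circ> (s + t) = (to_ac \<circ> s) + (to_ac \<circ> t)"
  by (simp add: fun_eq_iff)

lemma to_ac_comp_scale: "to_ac \<circ> seq_scale a s = seq_scale (to_ac a) (to_ac \<circ> s)"
  by (simp add: fun_eq_iff seq_scale_def)

lemma to_ac_comp_zero: "to_ac \<circ> 0 = 0"
  by (simp add: fun_eq_iff)

lemma to_ac_comp_hurwitz: "to_ac \<circ> hurwitz c d = hurwitz (to_ac \<circ> c) (to_ac \<circ> d)"
  by (simp add: fun_eq_iff hurwitz_def to_ac_sum)

lemma extend_scalars_span: "extend_scalars (seqs.span A) = seqs.span ((\<circ>) to_ac ` A)"
proof -
  have "to_ac \<circ> s \<in> seqs.span ((\<circ>) to_ac ` A)" if "s \<in> seqs.span A" for s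
    using that
  proof (induction rule: seqs.span_induct_alt)
    case base
    show ?case unfolding to_ac_comp_zero by (rule seqs.span_zero)
  next
    case (step c x y)
    then show ?case unfolding to_ac_comp_add to_ac_comp_scale
      by (blast intro: seqs.span_add seqs.span_scale seqs.span_base)
  qed
  moreover have "(\<circ>) to_ac ` A \<subseteq> seqs.span ((\<circ>) to_ac ` seqs.span A)"
    by (auto intro: seqs.span_base)
  ultimately show ?thesis unfolding extend_scalars_def seqs.span_eq by blast
qed

text \<open>Both sides are spanned over the closure by the images of the products
  \<open>hurwitz c d\<close>, because \<open>to_ac\<close> is a ring homomorphism.\<close>

lemma extend_scalars_hurwitz_space:
  "extend_scalars (hurwitz_space A B) = hurwitz_space (extend_scalars A) (extend_scalars B)"
proof -
  have "(\<circ>) to_ac ` {hurwitz c d | c d. c \<in> A \<and> d \<in> B}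
      = {hurwitz c d | c d. c \<in> (\<circ>) to_ac ` A \<and> d \<in> (\<circ>) to_ac ` B}"
    (is "?L = ?R")
  proof
    have "to_ac \<circ> hurwitz c d \<in> ?R" if "c \<in> A" "d \<in> B" for c d
      unfolding to_ac_comp_hurwitz using that by blast
    then show "?L \<subseteq> ?R" by blast
    have "hurwitz (to_ac \<circ> c) (to_ac \<circ> d) \<in> ?L" if "c \<in> A" "d \<in> B" for c d
      unfolding to_ac_comp_hurwitz [symmetric] using that by blast
    then show "?R \<subseteq> ?L" by blast
  qed
  then show ?thesis
    unfolding hurwitz_space_def [of A B] extend_scalars_span
    unfolding extend_scalars_def hurwitz_space_span by simp
qed

lemma to_ac_comp_in_lin_rec_iff: "to_ac \<circ> s \<in> lin_rec (map_poly to_ac P) \<longleftrightarrow> s \<in> lin_rec P"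
proof -
  have "to_ac (s (n + d)) + (\<Sum>i<d. to_ac (Polynomial.coeff P i) * to_ac (s (n + i)))
    = to_ac (s (n + d) + (\<Sum>i<d. Polynomial.coeff P i * s (n + i)))" for n d
    by (simp add: to_ac_sum)
  then show ?thesis
    by (simp only: lin_rec_def mem_Collect_eq degree_map_to_ac coeff_map_to_ac o_apply to_ac_eq_0_iff)
qed

lemma sum_seq_apply: "(\<Sum>x\<in>A. f x) n = (\<Sum>x\<in>A. f x n)" for f :: "'b \<Rightarrow> nat \<Rightarrow> 'a::field"
  by (induction A rule: infinite_finite_induct) auto

text \<open>Solutions whose initial values are unit vectors exist over the base field and span all
  solutions over the closure.\<close>

lemma extend_scalars_lin_rec:
  assumes "Polynomial.lead_coeff P = 1"
  shows "extend_scalars (lin_rec P) = lin_rec (map_poly to_ac P)"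
proof
  have "seqs.subspace (lin_rec (map_poly to_ac P))"
    using assms by (intro subspace_lin_rec) simp
  then show sub: "extend_scalars (lin_rec P) \<subseteq> lin_rec (map_poly to_ac P)"
    unfolding extend_scalars_def
    by (intro seqs.span_minimal) (auto simp: to_ac_comp_in_lin_rec_iff)
  show "lin_rec (map_poly to_ac P) \<subseteq> extend_scalars (lin_rec P)"
  proof
    fix s assume s: "s \<in> lin_rec (map_poly to_ac P)"
    define b where "b j = rec_seq P (\<lambda>i. if i = j then 1 else 0)" for j
    \<comment> \<open>The combination of the fundamental solutions with the initial values of
      \<open>s\<close> as coefficients; it agrees with \<open>s\<close> on the first terms.\<close>
    define u where "u = (\<Sum>j<Polynomial.degree P. seq_scale (s j) (to_ac \<circ> b j))"
    have u: "u \<in> extend_scalars (lin_rec P)"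
      unfolding u_def extend_scalars_def b_def
      by (intro seqs.span_sum seqs.span_scale seqs.span_base imageI rec_seq_in_lin_rec)
    have "s = u"
    proof (rule lin_rec_eqI [OF s])
      show "u \<in> lin_rec (map_poly to_ac P)" using u sub by blast
      fix n assume "n < Polynomial.degree (map_poly to_ac P)"
      then show "s n = u n"
        by (simp add: u_def sum_seq_apply seq_scale_def b_def rec_seq_init if_distrib cong: if_cong)
    qed
    then show "s \<in> extend_scalars (lin_rec P)" using u by simp
  qed
qed

section \<open>Descent to the base field\<close>

text \<open>A coefficient can be read off from a solution: if the initial values form the
  \<open>i\<close>-th unit vector, the next term is minus the \<open>i\<close>-th
  coefficient.\<close>

lemma lin_rec_inject:
  assumes "Polynomial.lead_coeff P = 1" "Polynomial.lead_coeff Q = 1"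
    and deg: "Polynomial.degree P = Polynomial.degree Q" and sub: "lin_rec P \<subseteq> lin_rec Q"
  shows "P = Q"
proof (rule poly_eqI)
  fix i
  define d where "d = Polynomial.degree Q"
  consider "i < d" | "i = d" | "i > d" by linarith
  then show "Polynomial.coeff P i = Polynomial.coeff Q i"
  proof cases
    case 1
    define s where "s = rec_seq P (\<lambda>j. if j = i then 1 else 0)"
    have init: "s j = (if j = i then 1 else 0)" if "j < d" for j
      using that by (simp add: s_def rec_seq_init deg d_def)
    have "s d = - Polynomial.coeff R i" if "s \<in> lin_rec R" "Polynomial.degree R = d" for R
    proof -
      have "s (0 + d) + (\<Sum>j<d. Polynomial.coeff R j * s (0 + j)) = 0"
        using that unfolding lin_rec_def by blast
      moreover have "(\<Sum>j<d. Polynomial.coeff R j * s (0 + j)) = Polynomial.coeff R i"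
        using 1 by (simp add: init if_distrib cong: if_cong)
      ultimately show ?thesis by (simp add: eq_neg_iff_add_eq_0)
    qed
    moreover have "s \<in> lin_rec P" unfolding s_def by (rule rec_seq_in_lin_rec)
    ultimately show ?thesis using sub deg d_def by (metis neg_equal_iff_equal subsetD)
  next
    case 2
    then show ?thesis using assms(1,2) deg by (simp add: d_def)
  next
    case 3
    then show ?thesis using deg by (simp add: d_def coeff_eq_0)
  qed
qed

text \<open>The closure is a vector space over the base field through \<open>to_ac\<close>, and the
  assignment of 1 to the independent vector 1 extends linearly. The second and third properties give
  \<open>\<phi> (to_ac a) = a\<close>.\<close>

lemma linear_retraction_exists:
  obtains \<phi> :: "'a::field alg_closure \<Rightarrow> 'a"
  where "\<And>x y. \<phi> (x + y) = \<phi> x + \<phi> y" "\<And>a x. \<phi> (to_ac a * x) = a * \<phi> x" "\<phi> 1 = 1"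
proof -
  interpret vector_space_pair "\<lambda>a x. to_ac (a :: 'a) * x" "\<lambda>a x. a * (x :: 'a)"
    by unfold_locales (auto simp: algebra_simps)
  have "vs1.independent {1}" by (simp add: vs1.dependent_single)
  from linear_independent_extend [OF this, of "\<lambda>_. 1"]
  obtain g where g: "Vector_Spaces.linear (\<lambda>a x. to_ac (a :: 'a) * x) (\<lambda>a x. a * x) g" "g 1 = 1"
    by auto
  then interpret g: Vector_Spaces.linear "\<lambda>a x. to_ac (a :: 'a) * x" "\<lambda>a x. a * x" g by simp
  show thesis using that [of g] g.add g.scale g(2) by blast
qed

lemma lin_rec_descent:
  fixes \<Psi> :: "'a::field alg_closure poly"
  assumes monic: "Polynomial.lead_coeff \<Psi> = 1"
    and H: "seqs.subspace H" and ext: "extend_scalars H = lin_rec \<Psi>"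
  shows "\<exists>Q. map_poly to_ac Q = \<Psi> \<and> H = lin_rec Q"
proof -
  obtain \<phi> :: "'a alg_closure \<Rightarrow> 'a" where add: "\<And>x y. \<phi> (x + y) = \<phi> x + \<phi> y"
    and scale: "\<And>a x. \<phi> (to_ac a * x) = a * \<phi> x" and one: "\<phi> 1 = 1"
    by (rule linear_retraction_exists) blast
  have zero: "\<phi> 0 = 0" using scale [of 0 0] by simp
  have scale': "\<phi> (x * to_ac a) = \<phi> x * a" for a x using scale [of a x] by (simp add: mult.commute)
  have retract: "\<phi> (to_ac a) = a" for a using scale [of a 1] one by simp
  have sum: "\<phi> (sum f A) = (\<Sum>x\<in>A. \<phi> (f x))" for f and A :: "nat set"
    by (induction A rule: infinite_finite_induct) (auto simp: zero add)
  define Q where "Q = map_poly \<phi> \<Psi>"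
  have coeff: "Polynomial.coeff Q i = \<phi> (Polynomial.coeff \<Psi> i)" for i
    unfolding Q_def using zero by (simp add: coeff_map_poly)
  have deg: "Polynomial.degree Q = Polynomial.degree \<Psi>"
  proof (rule antisym)
    show "Polynomial.degree Q \<le> Polynomial.degree \<Psi>" unfolding Q_def by (rule map_poly_degree_leq)
    show "Polynomial.degree \<Psi> \<le> Polynomial.degree Q" using monic one by (intro le_degree) (simp add: coeff)
  qed
  have monic_Q: "Polynomial.lead_coeff Q = 1" using monic one by (simp add: coeff deg)
  have H_sub: "H \<subseteq> lin_rec Q"
  proof
    fix h assume "h \<in> H"
    then have "to_ac \<circ> h \<in> lin_rec \<Psi>"
      unfolding ext [symmetric] extend_scalars_def by (blast intro: seqs.span_base)
    \<comment> \<open>Since the terms of \<open>h\<close> lie in the base field,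
      \<open>\<phi>\<close> passes through them and acts on the coefficients of
      \<open>\<Psi>\<close> alone.\<close>
    then have "\<phi> (to_ac (h (n + Polynomial.degree \<Psi>)) +
        (\<Sum>i<Polynomial.degree \<Psi>. Polynomial.coeff \<Psi> i * to_ac (h (n + i)))) = 0" for n
      by (simp add: lin_rec_def zero)
    then show "h \<in> lin_rec Q"
      by (simp add: lin_rec_def deg coeff add sum scale' retract)
  qed
  have "lin_rec \<Psi> \<subseteq> lin_rec (map_poly to_ac Q)"
    unfolding ext [symmetric] extend_scalars_lin_rec [OF monic_Q, symmetric]
    unfolding extend_scalars_def using H_sub by (intro seqs.span_mono image_mono)
  then have eq: "map_poly to_ac Q = \<Psi>"
    using monic monic_Q deg by (intro lin_rec_inject [symmetric]) auto
  \<comment> \<open>On a generator, \<open>\<phi>\<close> turns \<open>c\<close> times the image of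
    \<open>h\<close> into \<open>\<phi> c\<close> times \<open>h\<close>, which stays in the
    subspace \<open>H\<close>.\<close>
  have retract_mem: "\<phi> \<circ> u \<in> H" if "u \<in> extend_scalars H" for u
    using that unfolding extend_scalars_def
  proof (induction rule: seqs.span_induct_alt)
    case base
    have "\<phi> \<circ> (0 :: nat \<Rightarrow> 'a alg_closure) = 0" by (simp add: fun_eq_iff zero)
    then show ?case using seqs.subspace_0 [OF H] by argo
  next
    case (step c x y)
    then obtain h where h: "h \<in> H" "x = to_ac \<circ> h" by blast
    have "\<phi> \<circ> (seq_scale c x + y) = seq_scale (\<phi> c) h + (\<phi> \<circ> y)"
      by (simp add: fun_eq_iff h seq_scale_def add scale')
    then show ?case using step h H by (simp only: seqs.subspace_add seqs.subspace_scale)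
  qed
  have "lin_rec Q \<subseteq> H"
  proof
    fix s assume "s \<in> lin_rec Q"
    then have "to_ac \<circ> s \<in> extend_scalars H"
      unfolding ext eq [symmetric] by (simp add: to_ac_comp_in_lin_rec_iff)
    then have "\<phi> \<circ> (to_ac \<circ> s) \<in> H" by (rule retract_mem)
    moreover have "\<phi> \<circ> (to_ac \<circ> s) = s" by (simp add: fun_eq_iff retract)
    ultimately show "s \<in> H" by simp
  qed
  with H_sub eq show ?thesis by blast
qed

section \<open>Iterated products and the conclusion\<close>

lemma extend_scalars_lin_rec_eq_exp_span:
  assumes "Polynomial.lead_coeff P = 1"
  shows "extend_scalars (lin_rec P) = exp_span {(\<gamma>, t). t < root_mult \<gamma> P}"
  using assms unfolding extend_scalars_lin_rec [OF assms] root_mult_def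
  by (intro lin_rec_eq_exp_span) simp

text \<open>Appending a polynomial corresponds to one more Hurwitz product on the left and to one
  more \<open>exp_conv\<close> on the right.\<close>

lemma extend_scalars_iter:
  assumes "Ps \<noteq> []" "\<And>P. P \<in> set Ps \<Longrightarrow> Polynomial.lead_coeff P = 1"
  shows "extend_scalars (iter hurwitz_space (map lin_rec Ps)) = exp_span {(\<gamma>, t). t < psi_exp Ps \<gamma>}"
  using assms
proof (induction Ps rule: rev_nonempty_induct)
  case (single P)
  then have "P \<noteq> 0" by auto
  with single show ?case by (simp add: extend_scalars_lin_rec_eq_exp_span psi_exp_singleton)
next
  case (snoc P Ps)
  have "0 \<notin> set Ps" "P \<noteq> 0" using snoc.prems by fastforce+
  with snoc show ?case
    by (simp add: iter_snoc psi_exp_snoc extend_scalars_hurwitz_space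
        extend_scalars_lin_rec_eq_exp_span hurwitz_space_exp_span)
qed

theorem theorem5p7:
  fixes Ps :: "'a::field poly list"
  assumes "length Ps \<ge> 1"
    and "\<And>P. P \<in> set Ps \<Longrightarrow> Polynomial.lead_coeff P = 1 \<and> Polynomial.degree P > 0"
  shows "\<exists>Q :: 'a poly. map_poly to_ac Q = Psi Ps \<and>
           iter hurwitz_space (map lin_rec Ps) = lin_rec Q"
proof (rule lin_rec_descent)
  have ne: "Ps \<noteq> []" using assms(1) by auto
  have nz: "0 \<notin> set Ps" using assms(2) by fastforce
  show "Polynomial.lead_coeff (Psi Ps) = 1" by (rule monic_Psi)
  \<comment> \<open>For a single polynomial the space is \<open>lin_rec\<close> of it, and otherwise
    it is a span.\<close>
  show "seqs.subspace (iter hurwitz_space (map lin_rec Ps))"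
    using ne assms(2)
    by (cases Ps rule: rev_cases; cases "butlast Ps = []")
      (auto simp: iter_snoc hurwitz_space_def intro: subspace_lin_rec)
  \<comment> \<open>Both sides are the span of the same exponential sequences, since the
    multiplicities of the roots of \<open>Psi Ps\<close> are given by
    \<open>psi_exp Ps\<close>.\<close>
  show "extend_scalars (iter hurwitz_space (map lin_rec Ps)) = lin_rec (Psi Ps)"
    using ne assms(2)
    by (simp add: extend_scalars_iter lin_rec_eq_exp_span monic_Psi order_Psi nz)
qed

end
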